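(* For every finite set of formulas $T\subseteq\mathcal{L}_{\Box\Diamond}$ and every formula $\varphi\in\mathcal{L}_{\Box\Diamond}$: $T\models_{\Pi^*\mathcal{G}}\varphi$ if and only if $T\vdash_{KD45(\mathbf{G})}\varphi$.
   Context: Language. Fix a countable set $Var$ of propositional variables. $\mathcal{L}_{\Box\Diamond}$ is the set of formulas built from $Var$ and the constant $\bot$ with the binary connectives $\wedge,\to$ and the unary operators $\Box,\Diamond$. Abbreviations: $\top := \bot\to\bot$, $\neg\varphi := \varphi\to\bot$, $\varphi\vee\psi := ((\varphi\to\psi)\to\psi)\wedge((\psi\to\varphi)\to\varphi)$. Calculus. Gödel propositional logic $G$ has modus ponens as its rule and the axiom schemes: $(\varphi\to\psi)\to((\psi\to\chi)\to(\varphi\to\chi))$; $(\varphi\wedge\psi)\to\varphi$; $(\varphi\wedge\psi)\to(\psi\wedge\varphi)$; $(\varphi\to(\psi\to\chi))\to((\varphi\wedge\psi)\to\chi)$; $((\varphi\wedge\psi)\to\chi)\to(\varphi\to(\psi\to\chi))$; $\varphi\to(\varphi\wedge\varphi)$; $((\varphi\to\psi)\to\chi)\to(((\psi\to\varphi)\to\chi)\to\chi)$; $\bot\to\varphi$. The logic $K(\mathbf{G})$ consists of $G$ over the modal language together with the axiom schemes $\Box(\varphi\to\psi)\to(\Box\varphi\to\Box\psi)$; $\Diamond(\varphi\vee\psi)\to(\Diamond\varphi\vee\Diamond\psi)$; $\Box\top$; $\neg\Diamond\bot$; $\Box(\varphi\to\psi)\to(\Diamond\varphi\to\Diamond\psi)$;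 $(\Diamond\varphi\to\Box\psi)\to\Box(\varphi\to\psi)$; and the rule (Nec): from $\varphi$ infer $\Box\varphi$. The logic $K45(\mathbf{G})$ is $K(\mathbf{G})$ plus the axiom schemes $\Box\varphi\to\Box\Box\varphi$; $\Diamond\Diamond\varphi\to\Diamond\varphi$; $\Diamond\Box\varphi\to\Box\varphi$; $\Diamond\varphi\to\Box\Diamond\varphi$. The logic $KD45(\mathbf{G})$ is $K45(\mathbf{G})$ plus the axiom $\Diamond\top$. $T\vdash_{KD45(\mathbf{G})}\varphi$ means that $\varphi$ is derivable from assumptions $T$ and the axioms of $KD45(\mathbf{G})$ by modus ponens and (Nec), where (Nec) may be applied only when its premise is a theorem (derivable without assumptions). Semantics. On $[0,1]$ let $x\Rightarrow y = 1$ if $x\le y$ and $x\Rightarrow y=y$ otherwise. A normalised possibilistic Gödel Kripke model ($\Pi^*G$-model) is a triple $\langle W,\pi,e\rangle$ with $W$ a non-empty set, $\pi:W\to[0,1]$ a map with $\sup_{w\in W}\pi(w)=1$, and $e:W\times Var\to[0,1]$ an arbitrary map. $e$ is extended to all formulas by $e(w,\bot)=0$, $e(w,\varphi\wedge\psi)=\min(e(w,\varphi),e(w,\psi))$, $e(w,\varphi\to\psi)=e(w,\varphi)\Rightarrow e(w,\psi)$, $e(w,\Box\varphi)=\inf_{w'\in W}\{\pi(w')\Rightarrow e(w',\varphi)\}$, $e(w,\Diamond\varphi)=\sup_{w'\in W}\{\min(\pi(w'),e(w',\varphi))\}$. $T\models_{\Pi^*\mathcal{G}}\varphi$ means: for every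 $\Pi^*G$-model $\langle W,\pi,e\rangle$ and every $w\in W$, if $e(w,\psi)=1$ for all $\psi\in T$ then $e(w,\varphi)=1$. *)

theory Defs
  imports Complex_Main "HOL-Library.Countable"
begin

datatype 'v fm =
    Var 'v
  | Bot
  | And "'v fm" "'v fm"
  | Imp "'v fm" "'v fm"
  | Box "'v fm"
  | Dia "'v fm"

abbreviation Top :: "'v fm" where
  "Top \<equiv> Imp Bot Bot"

abbreviation Neg :: "'v fm \<Rightarrow> 'v fm" where
  "Neg p \<equiv> Imp p Bot"

abbreviation Or :: "'v fm \<Rightarrow> 'v fm \<Rightarrow> 'v fm" where
  "Or p q \<equiv> And (Imp (Imp p q) q) (Imp (Imp q p) p)"

inductive G_axiom :: "'v fm \<Rightarrow> bool" where
  G1: "G_axiom (Imp (Imp p q) (Imp (Imp q r) (Imp p r)))"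
| G2: "G_axiom (Imp (And p q) p)"
| G3: "G_axiom (Imp (And p q) (And q p))"
| G4: "G_axiom (Imp (Imp p (Imp q r)) (Imp (And p q) r))"
| G5: "G_axiom (Imp (Imp (And p q) r) (Imp p (Imp q r)))"
| G6: "G_axiom (Imp p (And p p))"
| G7: "G_axiom (Imp (Imp (Imp p q) r) (Imp (Imp (Imp q p) r) r))"
| G8: "G_axiom (Imp Bot p)"

inductive KG_axiom :: "'v fm \<Rightarrow> bool" where
  G: "G_axiom p \<Longrightarrow> KG_axiom p"
| K_Box: "KG_axiom (Imp (Box (Imp p q)) (Imp (Box p) (Box q)))"
| K_Dia: "KG_axiom (Imp (Dia (Or p q)) (Or (Dia p) (Dia q)))"
| F_Box: "KG_axiom (Box Top)"
| F_Dia: "KG_axiom (Neg (Dia Bot))"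
| FS1: "KG_axiom (Imp (Box (Imp p q)) (Imp (Dia p) (Dia q)))"
| FS2: "KG_axiom (Imp (Imp (Dia p) (Box q)) (Box (Imp p q)))"

inductive K45G_axiom :: "'v fm \<Rightarrow> bool" where
  KG: "KG_axiom p \<Longrightarrow> K45G_axiom p"
| Four_Box: "K45G_axiom (Imp (Box p) (Box (Box p)))"
| Four_Dia: "K45G_axiom (Imp (Dia (Dia p)) (Dia p))"
| Five_Box: "K45G_axiom (Imp (Dia (Box p)) (Box p))"
| Five_Dia: "K45G_axiom (Imp (Dia p) (Box (Dia p)))"

inductive KD45G_axiom :: "'v fm \<Rightarrow> bool" where
  K45G: "K45G_axiom p \<Longrightarrow> KD45G_axiom p"
| D: "KD45G_axiom (Dia Top)"

(* Necessitation applies to theorems only, hence the empty set of assumptions in its premise. *)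
inductive KD45G_derives :: "'v fm set \<Rightarrow> 'v fm \<Rightarrow> bool" where
  Assm: "p \<in> T \<Longrightarrow> KD45G_derives T p"
| Ax: "KD45G_axiom p \<Longrightarrow> KD45G_derives T p"
| MP: "KD45G_derives T p \<Longrightarrow> KD45G_derives T (Imp p q) \<Longrightarrow> KD45G_derives T q"
| Nec: "KD45G_derives {} p \<Longrightarrow> KD45G_derives T (Box p)"

definition godel_imp :: "real \<Rightarrow> real \<Rightarrow> real" where
  "godel_imp x y = (if x \<le> y then 1 else y)"

definition PiG_model :: "'w set \<Rightarrow> ('w \<Rightarrow> real) \<Rightarrow> ('w \<Rightarrow> 'v \<Rightarrow> real) \<Rightarrow> bool" where
  "PiG_model W \<pi> e \<longleftrightarrow>
     W \<noteq> {} \<and>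
     (\<forall>w\<in>W. \<pi> w \<in> {0..1}) \<and>
     (SUP w\<in>W. \<pi> w) = 1 \<and>
     (\<forall>w\<in>W. \<forall>x. e w x \<in> {0..1})"

(* In a model, W is non-empty and all values lie in [0,1], so the real-valued
   INF and SUP below are genuine infima and suprema. *)
primrec ext_val ::
  "'w set \<Rightarrow> ('w \<Rightarrow> real) \<Rightarrow> ('w \<Rightarrow> 'v \<Rightarrow> real) \<Rightarrow> 'w \<Rightarrow> 'v fm \<Rightarrow> real" where
  "ext_val W \<pi> e w (Var x) = e w x"
| "ext_val W \<pi> e w Bot = 0"
| "ext_val W \<pi> e w (And p q) = min (ext_val W \<pi> e w p) (ext_val W \<pi> e w q)"
| "ext_val W \<pi> e w (Imp p q) = godel_imp (ext_val W \<pi> e w p) (ext_val W \<pi> e w q)"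
| "ext_val W \<pi> e w (Box p) = (INF w'\<in>W. godel_imp (\<pi> w') (ext_val W \<pi> e w' p))"
| "ext_val W \<pi> e w (Dia p) = (SUP w'\<in>W. min (\<pi> w') (ext_val W \<pi> e w' p))"

(* HOL cannot quantify over all types inside a formula, so the type 'w from which the
   sets W of worlds are taken is a parameter. It should be infinite: a finite 'w admits only
   models of bounded finite size, whereas an infinite one admits all countable models. *)
definition PiG_entails :: "'w itself \<Rightarrow> 'v fm set \<Rightarrow> 'v fm \<Rightarrow> bool" where
  "PiG_entails TYPE('w) T p \<longleftrightarrow>
     (\<forall>(W :: 'w set) \<pi> e. PiG_model W \<pi> e \<longrightarrow>
        (\<forall>w\<in>W. (\<forall>q\<in>T. ext_val W \<pi> e w q = 1) \<longrightarrow> ext_val W \<pi> e w p = 1))"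

lemma ext_val_image:
  assumes "inj f" "w \<in> W"
  shows "ext_val (f ` W) (\<lambda>a. \<pi> (inv f a)) (\<lambda>a. e (inv f a)) (f w) p = ext_val W \<pi> e w p"
  using assms(2)
proof (induction p arbitrary: w)
  case (Box p)
  have "(\<lambda>w'. godel_imp (\<pi> w') (ext_val (f ` W) (\<lambda>a. \<pi> (inv f a)) (\<lambda>a. e (inv f a)) (f w') p)) ` W
      = (\<lambda>w'. godel_imp (\<pi> w') (ext_val W \<pi> e w' p)) ` W"
    by (intro image_cong) (simp_all add: Box)
  then show ?case by (simp add: image_image inv_f_f[OF assms(1)])
next
  case (Dia p)
  have "(\<lambda>w'. min (\<pi> w') (ext_val (f ` W) (\<lambda>a. \<pi> (inv f a)) (\<lambda>a. e (inv f a)) (f w') p)) ` W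
      = (\<lambda>w'. min (\<pi> w') (ext_val W \<pi> e w' p)) ` W"
    by (intro image_cong) (simp_all add: Dia)
  then show ?case by (simp add: image_image inv_f_f[OF assms(1)])
qed (simp_all add: inv_f_f[OF assms(1)])

(* Models over a type that embeds into 'b are already covered by PiG_entails TYPE('b);
   hence infinite types between them cover the models over every type. *)
lemma PiG_entails_inj:
  fixes f :: "'a \<Rightarrow> 'b"
  assumes f: "inj f" and ent: "PiG_entails TYPE('b) T p"
  shows "PiG_entails TYPE('a) T p"
  unfolding PiG_entails_def
proof (intro allI impI ballI)
  fix W :: "'a set" and \<pi> e w
  assume m: "PiG_model W \<pi> e" and w: "w \<in> W" and T: "\<forall>q\<in>T. ext_val W \<pi> e w q = 1"
  have "PiG_model (f ` W) (\<lambda>a. \<pi> (inv f a)) (\<lambda>a. e (inv f a))"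
    using m by (simp add: PiG_model_def image_image inv_f_f[OF f])
  moreover have "\<forall>q\<in>T. ext_val (f ` W) (\<lambda>a. \<pi> (inv f a)) (\<lambda>a. e (inv f a)) (f w) q = 1"
    using T by (simp add: ext_val_image[OF f w])
  ultimately have "ext_val (f ` W) (\<lambda>a. \<pi> (inv f a)) (\<lambda>a. e (inv f a)) (f w) p = 1"
    using ent w unfolding PiG_entails_def by blast
  then show "ext_val W \<pi> e w p = 1" by (simp add: ext_val_image[OF f w])
qed

end

theory Submission
  imports Defs
begin

text \<open>Every underivable \<open>\<phi>\<close> is excluded by a linearly ordered theory \<open>D\<close>, whose order on the finite
  set \<open>F\<close> of relevant formulas is realised by reals \<open>k\<close>. The worlds of the countermodel are
  propositional valuations in which each modal formula keeps its \<open>k\<close>-value. The witnesses of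
  \<open>Box p\<close> and \<open>Dia p\<close> come from linear theories \<open>E\<close> containing all \<open>q\<close> with \<open>m \<rightarrow> Box q \<in> D\<close>, for a
  modal formula \<open>m\<close>: in \<open>E\<close> the modal formulas strictly below \<open>m\<close> keep their strict order, so the
  formulas outside \<open>E\<close> can be given values below a number \<open>c \<le> k m\<close>, respecting both \<open>k\<close> and the
  order of \<open>E\<close>, while the formulas in \<open>E\<close> receive values at least \<open>c\<close>. Such a world can be given the weight \<open>c\<close>.\<close>

notation KD45G_derives (infix "\<turnstile>" 50)
notation Imp (infixr "\<rightarrow>" 60)

instance fm :: (countable) countable
  by countable_datatype

section \<open>Derivability\<close>

lemma ax_G: "G_axiom p \<Longrightarrow> T \<turnstile> p"
  by (intro KD45G_derives.Ax KD45G_axiom.K45G K45G_axiom.KG KG_axiom.G)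

lemma ax_KG: "KG_axiom p \<Longrightarrow> T \<turnstile> p"
  by (intro KD45G_derives.Ax KD45G_axiom.K45G K45G_axiom.KG)

lemma ax_K45G: "K45G_axiom p \<Longrightarrow> T \<turnstile> p"
  by (intro KD45G_derives.Ax KD45G_axiom.K45G)

lemma derives_mono: "S \<turnstile> p \<Longrightarrow> S \<subseteq> T \<Longrightarrow> T \<turnstile> p"
  by (induction rule: KD45G_derives.induct) (auto intro: KD45G_derives.intros)

lemma derives_trans: "T \<turnstile> p \<rightarrow> q \<Longrightarrow> T \<turnstile> q \<rightarrow> r \<Longrightarrow> T \<turnstile> p \<rightarrow> r"
  by (meson KD45G_derives.MP ax_G G_axiom.G1)

lemma derives_refl: "T \<turnstile> p \<rightarrow> p"
  by (meson derives_trans ax_G G_axiom.G2 G_axiom.G6)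

lemma derives_weaken: "T \<turnstile> p \<rightarrow> q \<rightarrow> p"
  by (meson KD45G_derives.MP ax_G G_axiom.G2 G_axiom.G5)

lemma derives_And_intro: "T \<turnstile> p \<rightarrow> q \<rightarrow> And p q"
  by (meson KD45G_derives.MP ax_G derives_refl G_axiom.G5)

lemma derives_exchange: "T \<turnstile> p \<rightarrow> q \<rightarrow> r \<Longrightarrow> T \<turnstile> q \<rightarrow> p \<rightarrow> r"
  by (meson KD45G_derives.MP ax_G derives_trans G_axiom.G3 G_axiom.G4 G_axiom.G5)

lemma derives_contract: "T \<turnstile> p \<rightarrow> p \<rightarrow> q \<Longrightarrow> T \<turnstile> p \<rightarrow> q"
  by (meson KD45G_derives.MP ax_G derives_trans G_axiom.G4 G_axiom.G6)

lemma derives_S: "T \<turnstile> p \<rightarrow> q \<rightarrow> r \<Longrightarrow> T \<turnstile> p \<rightarrow> q \<Longrightarrow> T \<turnstile> p \<rightarrow> r"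
  by (meson derives_trans derives_exchange derives_contract)

text \<open>The case \<open>Nec\<close> works because its premise has no assumptions: the boxed
  formula is derivable without \<open>p\<close> and is then weakened.\<close>

lemma deduction:
  assumes "insert p T \<turnstile> q"
  shows "T \<turnstile> p \<rightarrow> q"
  using assms
proof (induction "insert p T" q rule: KD45G_derives.induct)
  case (Assm q)
  then show ?case
    by (metis KD45G_derives.Assm KD45G_derives.MP derives_refl derives_weaken insertE)
next
  case (Ax q)
  then show ?case by (meson KD45G_derives.Ax KD45G_derives.MP derives_weaken)
next
  case (MP q r)
  then show ?case using derives_S by blast
next
  case (Nec q)
  then show ?case by (meson KD45G_derives.Nec KD45G_derives.MP derives_weaken)
qed

lemma derives_finite:
  assumes "T \<turnstile> p"
  shows "\<exists>S. finite S \<and> S \<subseteq> T \<and> S \<turnstile> p"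
  using assms
proof (induction rule: KD45G_derives.induct)
  case (Assm p T)
  then show ?case by (intro exI[of _ "{p}"]) (auto intro: KD45G_derives.Assm)
next
  case (MP T p q)
  then obtain S S' where "finite S" "S \<subseteq> T" "S \<turnstile> p" "finite S'" "S' \<subseteq> T" "S' \<turnstile> p \<rightarrow> q"
    by blast
  then show ?case
    by (intro exI[of _ "S \<union> S'"])
      (auto intro: KD45G_derives.MP[of _ p] elim: derives_mono)
qed (blast intro: KD45G_derives.intros)+

section \<open>Linear theories\<close>

text \<open>Read as an order, \<open>p \<rightarrow> q \<in> D\<close> turns the formulas into a
  chain with the members of \<open>D\<close> at the top. Closure is under derivations from
  \<open>D\<close>, which box theorems only, so \<open>D\<close> may contain \<open>p\<close>
  without \<open>Box p\<close>. Consistency is a separate condition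
  \<open>Bot \<notin> D\<close>.\<close>

definition linear_theory :: "'v fm set \<Rightarrow> bool" where
  "linear_theory D \<longleftrightarrow> (\<forall>p. D \<turnstile> p \<longrightarrow> p \<in> D) \<and> (\<forall>p q. p \<rightarrow> q \<in> D \<or> q \<rightarrow> p \<in> D)"

text \<open>Zorn's lemma yields a set maximal among those that do not derive \<open>r\<close>;
  unions of chains are handled by finiteness of derivations. By maximality every formula outside
  implies \<open>r\<close>, so by \<open>G7\<close> two opposite implications cannot both be
  missing.\<close>

lemma lindenbaum:
  assumes "\<not> S \<turnstile> r"
  obtains D where "S \<subseteq> D" "linear_theory D" "r \<notin> D"
proof -
  let ?A = "{D. S \<subseteq> D \<and> \<not> D \<turnstile> r}"
  have "\<exists>M\<in>?A. \<forall>X\<in>?A. M \<subseteq> X \<longrightarrow> X = M"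
  proof (rule subset_Zorn_nonempty)
    show "?A \<noteq> {}" using assms by blast
    fix C assume C: "C \<noteq> {}" "subset.chain ?A C"
    then have CA: "C \<subseteq> ?A" by (simp add: subset.chain_def)
    have "\<not> \<Union>C \<turnstile> r"
    proof
      assume "\<Union>C \<turnstile> r"
      then obtain X where X: "finite X" "X \<subseteq> \<Union>C" "X \<turnstile> r" using derives_finite by blast
      from finite_subset_Union_chain[OF X(1,2) C] obtain Y where "Y \<in> C" "X \<subseteq> Y" by blast
      then show False using CA derives_mono[OF X(3), of Y] by auto
    qed
    moreover have "S \<subseteq> \<Union>C" using C(1) CA by blast
    ultimately show "\<Union>C \<in> ?A" by simp
  qed
  then obtain D where "D \<in> ?A" and max': "\<forall>X\<in>?A. D \<subseteq> X \<longrightarrow> X = D" by (rule bexE)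
  then have D: "S \<subseteq> D" "\<not> D \<turnstile> r" by simp_all
  have max: "X = D" if "D \<subseteq> X" "\<not> X \<turnstile> r" for X
    using max' that D(1) by simp
  have out: "D \<turnstile> p \<rightarrow> r" if "p \<notin> D" for p
    using max[of "insert p D"] that deduction[of p D r] by blast
  have "p \<in> D" if "D \<turnstile> p" for p
    using out[of p] that D(2) KD45G_derives.MP by blast
  moreover have "p \<rightarrow> q \<in> D \<or> q \<rightarrow> p \<in> D" for p q
    using out[of "p \<rightarrow> q"] out[of "q \<rightarrow> p"] D(2) KD45G_derives.MP ax_G[OF G_axiom.G7] by metis
  ultimately have "linear_theory D" unfolding linear_theory_def by blast
  then show thesis using D KD45G_derives.Assm that by blast
qed

lemma
  assumes "linear_theory D"
  shows linear_theory_derives: "D \<turnstile> p \<Longrightarrow> p \<in> D"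
    and linear_theory_total: "p \<rightarrow> q \<in> D \<or> q \<rightarrow> p \<in> D"
    and linear_theory_thm: "{} \<turnstile> p \<Longrightarrow> p \<in> D"
    and linear_theory_MP: "p \<in> D \<Longrightarrow> p \<rightarrow> q \<in> D \<Longrightarrow> q \<in> D"
    and linear_theory_trans: "p \<rightarrow> q \<in> D \<Longrightarrow> q \<rightarrow> r \<in> D \<Longrightarrow> p \<rightarrow> r \<in> D"
    and linear_theory_weaken: "q \<in> D \<Longrightarrow> p \<rightarrow> q \<in> D"
  using assms unfolding linear_theory_def
  by (blast, blast, blast intro: derives_mono, blast intro: KD45G_derives.intros,
      blast intro: KD45G_derives.Assm derives_trans,
      blast intro: KD45G_derives.Assm KD45G_derives.MP derives_weaken)

section \<open>Conjunction and implication in the order of a linear theory\<close>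

lemma linear_theory_And1: "linear_theory D \<Longrightarrow> And p q \<rightarrow> p \<in> D"
  by (intro linear_theory_thm ax_G G_axiom.G2)

lemma linear_theory_And2: "linear_theory D \<Longrightarrow> And p q \<rightarrow> q \<in> D"
  by (meson linear_theory_thm linear_theory_trans ax_G G_axiom.G2 G_axiom.G3)

lemma linear_theory_And3:
  assumes "linear_theory D" "p \<rightarrow> q \<in> D"
  shows "p \<rightarrow> And p q \<in> D"
proof -
  have "D \<turnstile> p \<rightarrow> p \<rightarrow> And p q"
    using derives_trans KD45G_derives.Assm[OF assms(2)] derives_exchange derives_And_intro by meson
  then show ?thesis using assms(1) derives_contract linear_theory_derives by blast
qed

lemma linear_theory_And4:
  assumes "linear_theory D" "q \<rightarrow> p \<in> D"
  shows "q \<rightarrow> And p q \<in> D"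
  by (meson assms linear_theory_And3 linear_theory_thm linear_theory_trans ax_G G_axiom.G3)

lemma linear_theory_And_iff: "linear_theory D \<Longrightarrow> And p q \<in> D \<longleftrightarrow> p \<in> D \<and> q \<in> D"
  by (meson linear_theory_And1 linear_theory_And2 linear_theory_MP linear_theory_thm
      derives_And_intro)

lemma linear_theory_Imp1: "linear_theory D \<Longrightarrow> q \<rightarrow> p \<rightarrow> q \<in> D"
  by (intro linear_theory_thm derives_weaken)

text \<open>Linearity is applied to \<open>p\<close> and \<open>p \<rightarrow> q\<close>: contraction excludes \<open>p \<rightarrow> (p \<rightarrow> q)\<close>.\<close>

lemma linear_theory_Imp2:
  assumes "linear_theory D" "p \<rightarrow> q \<notin> D"
  shows "(p \<rightarrow> q) \<rightarrow> q \<in> D"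
proof -
  have "p \<rightarrow> p \<rightarrow> q \<notin> D"
    using assms by (meson KD45G_derives.Assm derives_contract linear_theory_derives)
  then have "(p \<rightarrow> q) \<rightarrow> p \<in> D" using assms(1) linear_theory_total by blast
  then have "D \<turnstile> (p \<rightarrow> q) \<rightarrow> p" by (rule KD45G_derives.Assm)
  then show ?thesis
    using assms(1) derives_S derives_refl linear_theory_derives by metis
qed

section \<open>Rigid formulas\<close>

text \<open>Abstracts what the 4 and 5 axioms say about boxed and diamond formulas, so that both are
  treated alike. \<open>Bot\<close> is covered too and supplies a least rigid formula.\<close>

definition rigid :: "'v fm \<Rightarrow> bool" where
  "rigid a \<longleftrightarrow> {} \<turnstile> a \<rightarrow> Box a \<and> {} \<turnstile> Dia a \<rightarrow> a"

lemma rigid_Box: "rigid (Box p)"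
  unfolding rigid_def by (intro conjI ax_K45G K45G_axiom.intros)

lemma rigid_Dia: "rigid (Dia p)"
  unfolding rigid_def by (intro conjI ax_K45G K45G_axiom.intros)

lemma rigid_Bot: "rigid Bot"
  unfolding rigid_def by (intro conjI ax_KG KG_axiom.F_Dia ax_G G_axiom.G8)

lemma rigid_thm:
  assumes "rigid a"
  shows "T \<turnstile> a \<rightarrow> Box a" "T \<turnstile> Dia a \<rightarrow> a"
  using assms derives_mono unfolding rigid_def by blast+

lemma linear_theory_rigid:
  assumes "linear_theory D" "rigid a"
  shows "a \<rightarrow> Box a \<in> D" "Dia a \<rightarrow> a \<in> D"
  using assms unfolding rigid_def by (simp_all add: linear_theory_thm)

lemma linear_theory_FS2:
  assumes "linear_theory D" "Dia p \<rightarrow> Box q \<in> D"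
  shows "Box (p \<rightarrow> q) \<in> D"
  using linear_theory_MP[OF assms] linear_theory_thm[OF assms(1) ax_KG[OF KG_axiom.FS2]] by simp

text \<open>Rigidity puts \<open>Dia a\<close> below \<open>a\<close>, which gives the premise of
  \<open>FS2\<close>.\<close>

lemma Box_Imp_rigid:
  assumes "linear_theory D" "rigid a" "a \<rightarrow> Box q \<in> D"
  shows "Box (a \<rightarrow> q) \<in> D"
  using linear_theory_FS2 linear_theory_trans linear_theory_rigid(2) assms by blast

text \<open>Comes from the boxed theorem
  \<open>p \<rightarrow> (p \<rightarrow> q) \<rightarrow> q\<close> by \<open>K_Box\<close> and
  then \<open>FS1\<close>.\<close>

lemma Dia_Imp: "{} \<turnstile> Dia (p \<rightarrow> q) \<rightarrow> Box p \<rightarrow> Dia q"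
proof -
  have "{} \<turnstile> Box (p \<rightarrow> (p \<rightarrow> q) \<rightarrow> q)"
    by (intro KD45G_derives.Nec derives_exchange[OF derives_refl])
  then have "{} \<turnstile> Box p \<rightarrow> Box ((p \<rightarrow> q) \<rightarrow> q)"
    by (meson KD45G_derives.MP ax_KG KG_axiom.K_Box)
  then have "{} \<turnstile> Box p \<rightarrow> Dia (p \<rightarrow> q) \<rightarrow> Dia q"
    by (meson derives_trans ax_KG KG_axiom.FS1)
  then show ?thesis by (rule derives_exchange)
qed

text \<open>\<open>Dia (a \<rightarrow> b)\<close> implies \<open>Box a \<rightarrow> Dia b\<close>,
  which by rigidity implies \<open>a \<rightarrow> b\<close>. As \<open>b\<close> is strictly below
  \<open>a\<close> in \<open>D\<close>, this is equivalent to \<open>b\<close> there, and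
  \<open>b\<close> implies \<open>Box b\<close>; \<open>FS2\<close> concludes. The boxed formula
  carries the strictness over to other theories.\<close>

lemma Box_Imp_Imp_rigid:
  assumes D: "linear_theory D" and a: "rigid a" and b: "rigid b" and ab: "a \<rightarrow> b \<notin> D"
  shows "Box ((a \<rightarrow> b) \<rightarrow> b) \<in> D"
proof -
  have "{Box a \<rightarrow> Dia b} \<turnstile> Box a \<rightarrow> Dia b" by (simp add: KD45G_derives.Assm)
  then have "{Box a \<rightarrow> Dia b} \<turnstile> a \<rightarrow> b"
    using derives_trans rigid_thm(1)[OF a] rigid_thm(2)[OF b] by blast
  then have "(Box a \<rightarrow> Dia b) \<rightarrow> a \<rightarrow> b \<in> D"
    using linear_theory_thm[OF D] deduction by blast
  then have "Dia (a \<rightarrow> b) \<rightarrow> a \<rightarrow> b \<in> D"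
    using linear_theory_trans[OF D] linear_theory_thm[OF D Dia_Imp] by blast
  then have "Dia (a \<rightarrow> b) \<rightarrow> Box b \<in> D"
    using linear_theory_Imp2[OF D ab] linear_theory_trans[OF D] linear_theory_rigid(1)[OF D b]
    by blast
  then show ?thesis by (rule linear_theory_FS2[OF D])
qed

text \<open>In a model a world of weight \<open>c\<close> gives \<open>p\<close> at least the value
  \<open>min (Box p) c\<close>. Hence if \<open>m\<close> is at most \<open>Box p\<close> and
  \<open>c\<close> at most \<open>m\<close>, then \<open>p\<close> has value at least
  \<open>c\<close> there. \<open>cut D m\<close> collects the formulas \<open>p\<close> forced in
  this way.\<close>

definition cut :: "'v fm set \<Rightarrow> 'v fm \<Rightarrow> 'v fm set" where
  "cut D m = {p. m \<rightarrow> Box p \<in> D}"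

lemma cut_Box: "linear_theory D \<Longrightarrow> Box p \<in> D \<Longrightarrow> p \<in> cut D m"
  unfolding cut_def by (simp add: linear_theory_weaken)

lemma cut_thm: "linear_theory D \<Longrightarrow> {} \<turnstile> p \<Longrightarrow> p \<in> cut D m"
  by (simp add: cut_Box KD45G_derives.Nec linear_theory_thm)

text \<open>Modus ponens is \<open>K_Box\<close> below the antecedent \<open>m\<close>; the other
  derivation steps give theorems, whose boxes are theorems again.\<close>

lemma cut_derives:
  assumes D: "linear_theory D" and "cut D m \<turnstile> p"
  shows "p \<in> cut D m"
  using assms(2)
proof (induction "cut D m" p rule: KD45G_derives.induct)
  case (MP p q)
  have p: "D \<turnstile> m \<rightarrow> Box p" and "D \<turnstile> m \<rightarrow> Box (p \<rightarrow> q)"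
    using MP unfolding cut_def by (auto intro: KD45G_derives.Assm)
  then have "D \<turnstile> m \<rightarrow> Box p \<rightarrow> Box q"
    using derives_trans[OF _ ax_KG[OF KG_axiom.K_Box]] by blast
  from derives_S[OF this p]
  show ?case unfolding cut_def by (simp add: linear_theory_derives[OF D])
next
  case (Ax p)
  then show ?case by (intro cut_thm[OF D] KD45G_derives.Ax)
next
  case (Nec p)
  then show ?case by (intro cut_thm[OF D] KD45G_derives.Nec)
qed

text \<open>Such an \<open>E\<close> orders the rigid formulas of \<open>F\<close> strictly below \<open>m\<close> as \<open>D\<close> does,
  but makes all those above \<open>m\<close> designated.\<close>

definition cut_theory :: "'v fm set \<Rightarrow> 'v fm set \<Rightarrow> 'v fm \<Rightarrow> 'v fm set \<Rightarrow> bool" where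
  "cut_theory F D m E \<longleftrightarrow> linear_theory E \<and> cut D m \<subseteq> E \<and>
     (\<forall>a\<in>F. rigid a \<longrightarrow> a \<in> E \<longrightarrow> m \<rightarrow> a \<in> D)"

section \<open>Rigid formulas in the theories that extend a cut\<close>

lemma cut_rigid:
  assumes "linear_theory D" "rigid a" "m \<rightarrow> a \<in> D"
  shows "a \<in> cut D m"
  using linear_theory_trans[OF assms(1,3) linear_theory_rigid(1)[OF assms(1,2)]]
  by (simp add: cut_def)

lemma cut_theory_rigid_iff:
  assumes "linear_theory D" "cut_theory F D m E" "a \<in> F" "rigid a"
  shows "a \<in> E \<longleftrightarrow> m \<rightarrow> a \<in> D"
  using assms cut_rigid[OF assms(1,4)] unfolding cut_theory_def by blast

text \<open>Both directions pass through boxed formulas of \<open>D\<close>: an implication in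
  \<open>D\<close> yields \<open>Box (a \<rightarrow> b)\<close>, a missing one yields
  \<open>Box ((a \<rightarrow> b) \<rightarrow> b)\<close>. In the latter case
  \<open>a \<rightarrow> b \<in> E\<close> would force \<open>b \<in> E\<close>.\<close>

lemma cut_theory_order:
  assumes D: "linear_theory D" and E: "cut_theory F D m E"
    and a: "rigid a" and b: "rigid b" "b \<notin> E"
  shows "a \<rightarrow> b \<in> E \<longleftrightarrow> a \<rightarrow> b \<in> D"
proof
  have E': "linear_theory E" "cut D m \<subseteq> E" using E unfolding cut_theory_def by auto
  show "a \<rightarrow> b \<in> D" if "a \<rightarrow> b \<in> E"
  proof (rule ccontr)
    assume "a \<rightarrow> b \<notin> D"
    then have "(a \<rightarrow> b) \<rightarrow> b \<in> E"
      using cut_Box[OF D Box_Imp_Imp_rigid[OF D a b(1)]] E'(2) by blast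
    then show False using linear_theory_MP[OF E'(1) that] b(2) by blast
  qed
  show "a \<rightarrow> b \<in> E" if "a \<rightarrow> b \<in> D"
  proof -
    have "a \<rightarrow> Box b \<in> D"
      by (rule linear_theory_trans[OF D that linear_theory_rigid(1)[OF D b(1)]])
    then show ?thesis using cut_Box[OF D Box_Imp_rigid[OF D a]] E'(2) by blast
  qed
qed

text \<open>The scheme enters \<open>E\<close> through its box: \<open>Box p\<close> is rigid and
  implies itself, so \<open>Box (Box p \<rightarrow> p)\<close> lies in \<open>D\<close>.\<close>

lemma cut_theory_Box:
  assumes D: "linear_theory D" and E: "cut_theory F D m E"
  shows "Box p \<rightarrow> p \<in> E"
proof -
  have "Box (Box p \<rightarrow> p) \<in> D"
    using D by (intro Box_Imp_rigid rigid_Box linear_theory_thm derives_refl)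
  then show ?thesis using E cut_Box[OF D] unfolding cut_theory_def by blast
qed

lemma cut_theory_Dia:
  assumes D: "linear_theory D" and E: "cut_theory F D m E"
  shows "p \<rightarrow> Dia p \<in> E"
proof -
  have "Box (p \<rightarrow> Dia p) \<in> D"
    by (intro linear_theory_FS2[OF D] linear_theory_thm[OF D] ax_K45G K45G_axiom.Five_Dia)
  then show ?thesis using E cut_Box[OF D] unfolding cut_theory_def by blast
qed

text \<open>\<open>E\<close> is an extension of the cut that avoids \<open>p\<close>. By
  \<open>least\<close>, no rigid formula of \<open>F\<close> lies strictly between
  \<open>Box p\<close> and \<open>m\<close>, so one that is not above \<open>m\<close> implies
  \<open>Box p\<close> in \<open>D\<close>, hence \<open>p\<close> in \<open>E\<close>, and
  therefore stays outside \<open>E\<close>.\<close>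

lemma exists_cut_theory_Box:
  assumes D: "linear_theory D" and m: "m \<rightarrow> Box p \<notin> D"
    and least: "\<And>a. a \<in> F \<Longrightarrow> rigid a \<Longrightarrow> m \<rightarrow> a \<in> D \<or> a \<rightarrow> Box p \<in> D"
  obtains E where "cut_theory F D m E" "p \<notin> E"
proof -
  have "\<not> cut D m \<turnstile> p" using cut_derives[OF D, of m p] m by (auto simp: cut_def)
  then obtain E where E: "cut D m \<subseteq> E" "linear_theory E" "p \<notin> E" by (rule lindenbaum)
  have "m \<rightarrow> a \<in> D" if a: "a \<in> F" "rigid a" "a \<in> E" for a
  proof (rule ccontr)
    assume "m \<rightarrow> a \<notin> D"
    then have "a \<rightarrow> p \<in> E"
      using least[OF a(1,2)] cut_Box[OF D Box_Imp_rigid[OF D a(2)]] E(1) by blast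
    then show False using linear_theory_MP[OF E(2) a(3)] E(3) by blast
  qed
  then show thesis using that E unfolding cut_theory_def by blast
qed

text \<open>\<open>b\<close> acts as the greatest rigid formula of \<open>F\<close> strictly below
  \<open>Dia p\<close>, and \<open>E\<close> is built to contain \<open>p\<close> and to avoid
  \<open>b\<close>. If the cut together with \<open>p\<close> derived \<open>b\<close>, then
  \<open>Dia p\<close> would imply \<open>Box (p \<rightarrow> b)\<close>, hence by
  \<open>FS1\<close> \<open>Dia b\<close>, hence \<open>b\<close>.\<close>

lemma exists_cut_theory_Dia:
  assumes D: "linear_theory D" and b: "rigid b" "Dia p \<rightarrow> b \<notin> D"
    and greatest: "\<And>a. a \<in> F \<Longrightarrow> rigid a \<Longrightarrow> Dia p \<rightarrow> a \<in> D \<or> a \<rightarrow> b \<in> D"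
  obtains E where "cut_theory F D (Dia p) E" "p \<in> E"
proof -
  have "\<not> insert p (cut D (Dia p)) \<turnstile> b"
  proof
    assume "insert p (cut D (Dia p)) \<turnstile> b"
    then have "p \<rightarrow> b \<in> cut D (Dia p)" using cut_derives[OF D] deduction by blast
    then have "D \<turnstile> Dia p \<rightarrow> Box (p \<rightarrow> b)" unfolding cut_def by (simp add: KD45G_derives.Assm)
    then have "D \<turnstile> Dia p \<rightarrow> Dia b"
      using derives_contract[OF derives_trans[OF _ ax_KG[OF KG_axiom.FS1]]] by blast
    then have "D \<turnstile> Dia p \<rightarrow> b" by (rule derives_trans[OF _ rigid_thm(2)[OF b(1)]])
    then show False using b(2) D linear_theory_derives by blast
  qed
  then obtain E where E: "insert p (cut D (Dia p)) \<subseteq> E" "linear_theory E" "b \<notin> E"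
    by (rule lindenbaum)
  have "Dia p \<rightarrow> a \<in> D" if a: "a \<in> F" "rigid a" "a \<in> E" for a
  proof (rule ccontr)
    assume "Dia p \<rightarrow> a \<notin> D"
    then have "a \<rightarrow> Box b \<in> D"
      using greatest[OF a(1,2)] linear_theory_trans[OF D _ linear_theory_rigid(1)[OF D b(1)]]
      by blast
    then have "a \<rightarrow> b \<in> E" using cut_Box[OF D Box_Imp_rigid[OF D a(2)]] E(1) by blast
    then show False using linear_theory_MP[OF E(2) a(3)] E(3) by blast
  qed
  then show thesis using that E unfolding cut_theory_def by blast
qed

section \<open>Soundness\<close>

text \<open>Residuation of \<open>min\<close>. The bound on \<open>x\<close> reflects that an
  implication with \<open>a \<le> b\<close> has value 1 and not more.\<close>

lemma le_godel_imp_iff: "x \<le> 1 \<Longrightarrow> x \<le> godel_imp a b \<longleftrightarrow> min x a \<le> b"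
  by (auto simp: godel_imp_def)

lemma godel_imp_eq_1_iff: "a \<le> 1 \<Longrightarrow> godel_imp a b = 1 \<longleftrightarrow> a \<le> b"
  by (auto simp: godel_imp_def)

lemma godel_imp_unit: "b \<in> {0..1} \<Longrightarrow> godel_imp a b \<in> {0..1}"
  by (auto simp: godel_imp_def)

context
  fixes W :: "'w set" and \<pi> :: "'w \<Rightarrow> real" and e :: "'w \<Rightarrow> 'v \<Rightarrow> real"
  assumes model: "PiG_model W \<pi> e"
begin

lemma ext_val_unit: "w \<in> W \<Longrightarrow> ext_val W \<pi> e w p \<in> {0..1}"
proof (induction p arbitrary: w)
  case (Imp p q)
  then show ?case using godel_imp_unit by simp
next
  case (Box p)
  then have *: "godel_imp (\<pi> v) (ext_val W \<pi> e v p) \<in> {0..1}" if "v \<in> W" for v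
    using that by (intro godel_imp_unit)
  have "bdd_below ((\<lambda>v. godel_imp (\<pi> v) (ext_val W \<pi> e v p)) ` W)"
    using * by (intro bdd_belowI2[of _ 0]) auto
  then have "(INF v\<in>W. godel_imp (\<pi> v) (ext_val W \<pi> e v p)) \<le> 1"
    using cINF_lower[of "\<lambda>v. godel_imp (\<pi> v) (ext_val W \<pi> e v p)" W w] *[OF Box.prems] Box.prems
    by force
  moreover have "0 \<le> (INF v\<in>W. godel_imp (\<pi> v) (ext_val W \<pi> e v p))"
    using Box.prems * by (intro cINF_greatest) auto
  ultimately show ?case by simp
next
  case (Dia p)
  then have *: "min (\<pi> v) (ext_val W \<pi> e v p) \<in> {0..1}" if "v \<in> W" for v
    using that model unfolding PiG_model_def by (auto simp: min_le_iff_disj)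
  have "bdd_above ((\<lambda>v. min (\<pi> v) (ext_val W \<pi> e v p)) ` W)"
    using * by (intro bdd_aboveI2[of _ _ 1]) auto
  then have "0 \<le> (SUP v\<in>W. min (\<pi> v) (ext_val W \<pi> e v p))"
    using cSUP_upper[of w W "\<lambda>v. min (\<pi> v) (ext_val W \<pi> e v p)"] *[OF Dia.prems] Dia.prems
    by force
  moreover have "(SUP v\<in>W. min (\<pi> v) (ext_val W \<pi> e v p)) \<le> 1"
    using Dia.prems * by (intro cSUP_least) auto
  ultimately show ?case by simp
qed (use model in \<open>auto simp: PiG_model_def min_le_iff_disj\<close>)

lemma ext_val_le_1: "w \<in> W \<Longrightarrow> ext_val W \<pi> e w p \<le> 1"
  using ext_val_unit[of w p] by (simp only: atLeastAtMost_iff)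

text \<open>Combines the universal property of the infimum with residuation. Together with its dual
  for \<open>Dia\<close> it reduces the modal axioms to inequalities at single worlds.\<close>

lemma le_ext_val_Box_iff:
  assumes "x \<le> 1"
  shows "x \<le> ext_val W \<pi> e w (Box p) \<longleftrightarrow> (\<forall>v\<in>W. min x (\<pi> v) \<le> ext_val W \<pi> e v p)"
proof -
  have "bdd_below ((\<lambda>v. godel_imp (\<pi> v) (ext_val W \<pi> e v p)) ` W)"
    using godel_imp_unit[OF ext_val_unit] by (intro bdd_belowI2[of _ 0]) auto
  then have "x \<le> ext_val W \<pi> e w (Box p) \<longleftrightarrow> (\<forall>v\<in>W. x \<le> godel_imp (\<pi> v) (ext_val W \<pi> e v p))"
    using model by (simp add: le_cINF_iff PiG_model_def)
  then show ?thesis using assms by (simp add: le_godel_imp_iff)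
qed

lemma ext_val_Dia_le_iff:
  "ext_val W \<pi> e w (Dia p) \<le> x \<longleftrightarrow> (\<forall>v\<in>W. min (\<pi> v) (ext_val W \<pi> e v p) \<le> x)"
proof -
  have "bdd_above ((\<lambda>v. min (\<pi> v) (ext_val W \<pi> e v p)) ` W)"
    using model unfolding PiG_model_def
    by (intro bdd_aboveI2[of _ _ 1]) (auto simp: min_le_iff_disj)
  then show ?thesis using model by (simp add: cSUP_le_iff PiG_model_def)
qed

lemma ext_val_BoxD:
  "v \<in> W \<Longrightarrow> min (ext_val W \<pi> e v (Box p)) (\<pi> v) \<le> ext_val W \<pi> e v p"
  using le_ext_val_Box_iff[of "ext_val W \<pi> e v (Box p)" v p] ext_val_unit[of v "Box p"] by auto

lemma ext_val_DiaD:
  "v \<in> W \<Longrightarrow> min (\<pi> v) (ext_val W \<pi> e v p) \<le> ext_val W \<pi> e v (Dia p)"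
  using ext_val_Dia_le_iff[of v p "ext_val W \<pi> e v (Dia p)"] by auto

text \<open>Weights do not depend on the world of evaluation, so modal values are global; this
  validates the 4 and 5 axioms.\<close>

lemma ext_val_Box_const: "ext_val W \<pi> e w (Box p) = ext_val W \<pi> e v (Box p)"
  by simp

lemma ext_val_Dia_const: "ext_val W \<pi> e w (Dia p) = ext_val W \<pi> e v (Dia p)"
  by simp

lemma ext_val_Imp_eq_1_iff:
  "w \<in> W \<Longrightarrow> ext_val W \<pi> e w (p \<rightarrow> q) = 1 \<longleftrightarrow> ext_val W \<pi> e w p \<le> ext_val W \<pi> e w q"
  using ext_val_unit[of w p] by (simp add: godel_imp_eq_1_iff)

lemma le_ext_val_Imp_iff:
  "x \<le> 1 \<Longrightarrow> x \<le> ext_val W \<pi> e w (p \<rightarrow> q) \<longleftrightarrow> min x (ext_val W \<pi> e w p) \<le> ext_val W \<pi> e w q"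
  by (simp add: le_godel_imp_iff)

lemma ext_val_Or:
  "w \<in> W \<Longrightarrow> ext_val W \<pi> e w (Or p q) = max (ext_val W \<pi> e w p) (ext_val W \<pi> e w q)"
  using ext_val_unit[of w p] ext_val_unit[of w q] by (auto simp: godel_imp_def)

section \<open>Validity of the axioms\<close>

lemma G_axiom_sound:
  assumes "G_axiom p" "w \<in> W"
  shows "ext_val W \<pi> e w p = 1"
proof -
  note u = ext_val_unit[OF assms(2), simplified]
  show ?thesis using assms(1)
  proof cases
    case (G1 a b c)
    show ?thesis unfolding G1 using u[of a] u[of b] u[of c] by (simp add: godel_imp_def)
  next
    case (G7 a b c)
    show ?thesis unfolding G7 using u[of a] u[of b] u[of c] by (simp add: godel_imp_def)
  next
    case (G4 a b c)
    show ?thesis unfolding G4 using u[of a] u[of b] u[of c]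
      by (auto simp: godel_imp_def min_le_iff_disj)
  next
    case (G5 a b c)
    show ?thesis unfolding G5 using u[of a] u[of b] u[of c]
      by (auto simp: godel_imp_def min_le_iff_disj)
  qed (use u in \<open>simp_all add: godel_imp_def\<close>)
qed

lemma KG_axiom_sound:
  assumes "KG_axiom p" "w \<in> W"
  shows "ext_val W \<pi> e w p = 1"
proof -
  let ?V = "ext_val W \<pi> e"
  note u = ext_val_le_1[OF assms(2)]
  show ?thesis using assms(1)
  proof cases
    case G
    then show ?thesis using assms(2) by (rule G_axiom_sound)
  next
    case (K_Box p q)
    have "min (min (?V w (Box (p \<rightarrow> q))) (?V w (Box p))) (\<pi> v) \<le> ?V v q" if v: "v \<in> W" for v
    proof -
      have "min (?V w (Box (p \<rightarrow> q))) (\<pi> v) \<le> ?V v (p \<rightarrow> q)"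
        using ext_val_BoxD[OF v, of "p \<rightarrow> q"] ext_val_Box_const[of w "p \<rightarrow> q" v] by simp
      moreover have "?V w (Box (p \<rightarrow> q)) \<le> 1" by (rule u)
      ultimately have "min (min (?V w (Box (p \<rightarrow> q))) (\<pi> v)) (?V v p) \<le> ?V v q"
        by (subst (asm) le_ext_val_Imp_iff) auto
      moreover have "min (?V w (Box p)) (\<pi> v) \<le> ?V v p"
        using ext_val_BoxD[OF v, of p] ext_val_Box_const[of w p v] by simp
      ultimately show ?thesis by linarith
    qed
    moreover have "min (?V w (Box (p \<rightarrow> q))) (?V w (Box p)) \<le> 1" "?V w (Box (p \<rightarrow> q)) \<le> 1"
      using u by (simp_all del: ext_val.simps add: min_le_iff_disj)
    ultimately have "?V w (Box (p \<rightarrow> q)) \<le> ?V w (Box p \<rightarrow> Box q)"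
      by (simp only: le_ext_val_Imp_iff le_ext_val_Box_iff) blast
    then show ?thesis unfolding K_Box ext_val_Imp_eq_1_iff[OF assms(2)] .
  next
    case (K_Dia p q)
    have "min (\<pi> v) (?V v (Or p q)) \<le> max (?V w (Dia p)) (?V w (Dia q))" if v: "v \<in> W" for v
      using ext_val_DiaD[OF v, of p] ext_val_Dia_const[of w p v]
        ext_val_DiaD[OF v, of q] ext_val_Dia_const[of w q v]
      unfolding ext_val_Or[OF v] by linarith
    then show ?thesis
      unfolding K_Dia ext_val_Imp_eq_1_iff[OF assms(2)] ext_val_Or[OF assms(2)] ext_val_Dia_le_iff
      by blast
  next
    case F_Box
    have "1 \<le> ?V w (Box Top)"
      by (subst le_ext_val_Box_iff) (auto simp: godel_imp_def)
    then show ?thesis unfolding F_Box by (rule antisym[OF u])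
  next
    case F_Dia
    have "?V w (Dia Bot) \<le> 0"
      by (subst ext_val_Dia_le_iff) (auto simp: min_le_iff_disj)
    then show ?thesis unfolding F_Dia ext_val_Imp_eq_1_iff[OF assms(2)] by simp
  next
    case (FS1 p q)
    have "min (min (\<pi> v) (?V v p)) (?V w (Box (p \<rightarrow> q))) \<le> ?V w (Dia q)" if v: "v \<in> W" for v
    proof -
      have "min (?V w (Box (p \<rightarrow> q))) (\<pi> v) \<le> ?V v (p \<rightarrow> q)"
        using ext_val_BoxD[OF v, of "p \<rightarrow> q"] ext_val_Box_const[of w "p \<rightarrow> q" v] by simp
      moreover have "?V w (Box (p \<rightarrow> q)) \<le> 1" by (rule u)
      ultimately have "min (min (?V w (Box (p \<rightarrow> q))) (\<pi> v)) (?V v p) \<le> ?V v q"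
        by (subst (asm) le_ext_val_Imp_iff) auto
      then show ?thesis
        using ext_val_DiaD[OF v, of q] ext_val_Dia_const[of w q v] by linarith
    qed
    moreover have "min (\<pi> v) (?V v p) \<le> 1" if "v \<in> W" for v
      using ext_val_le_1[OF that] by (simp add: min_le_iff_disj)
    \<comment> \<open>Residuation moves the boxed formula to the right, which gives a bound
      independent of \<open>v\<close> and hence a bound for the supremum.\<close>
    ultimately have "min (\<pi> v) (?V v p) \<le> godel_imp (?V w (Box (p \<rightarrow> q))) (?V w (Dia q))"
      if "v \<in> W" for v
      using that by (subst le_godel_imp_iff) blast+
    then have "?V w (Dia p) \<le> godel_imp (?V w (Box (p \<rightarrow> q))) (?V w (Dia q))"
      unfolding ext_val_Dia_le_iff by blast
    then have "min (?V w (Dia p)) (?V w (Box (p \<rightarrow> q))) \<le> ?V w (Dia q)"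
      by (subst (asm) le_godel_imp_iff) (rule u)
    then have "?V w (Box (p \<rightarrow> q)) \<le> ?V w (Dia p \<rightarrow> Dia q)"
      by (subst le_ext_val_Imp_iff, intro u, subst min.commute)
    then show ?thesis unfolding FS1 ext_val_Imp_eq_1_iff[OF assms(2)] .
  next
    case (FS2 p q)
    let ?X = "?V w (Dia p \<rightarrow> Box q)"
    have X: "?X \<le> 1" by (rule u)
    have "min ?X (\<pi> v) \<le> ?V v (p \<rightarrow> q)" if v: "v \<in> W" for v
    proof -
      have "min ?X (?V w (Dia p)) \<le> ?V w (Box q)"
        using X by (simp only: le_ext_val_Imp_iff[symmetric])
      moreover have "min (\<pi> v) (?V v p) \<le> ?V w (Dia p)"
        using ext_val_DiaD[OF v, of p] ext_val_Dia_const[of w p v] by simp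
      moreover have "min (?V w (Box q)) (\<pi> v) \<le> ?V v q"
        using ext_val_BoxD[OF v, of q] ext_val_Box_const[of w q v] by simp
      ultimately have "min (min ?X (\<pi> v)) (?V v p) \<le> ?V v q" by linarith
      then show ?thesis using X by (subst le_ext_val_Imp_iff) auto
    qed
    then have "?X \<le> ?V w (Box (p \<rightarrow> q))"
      using X by (simp only: le_ext_val_Box_iff) blast
    then show ?thesis unfolding FS2 ext_val_Imp_eq_1_iff[OF assms(2)] .
  qed
qed

lemma KD45G_axiom_sound:
  assumes "KD45G_axiom p" "w \<in> W"
  shows "ext_val W \<pi> e w p = 1"
  using assms(1)
proof cases
  let ?V = "ext_val W \<pi> e"
  note u = ext_val_le_1[OF assms(2)]
  case K45G
  then show ?thesis
  proof cases
    case KG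
    then show ?thesis using assms(2) by (rule KG_axiom_sound)
  next
    case (Four_Box p)
    have "?V w (Box p) \<le> ?V w (Box (Box p))"
      unfolding le_ext_val_Box_iff[OF u]
      by (intro ballI, subst ext_val_Box_const[of _ p w]) (rule min.cobounded1)
    then show ?thesis unfolding Four_Box ext_val_Imp_eq_1_iff[OF assms(2)] .
  next
    case (Four_Dia p)
    have "?V w (Dia (Dia p)) \<le> ?V w (Dia p)"
      unfolding ext_val_Dia_le_iff
      by (intro ballI, subst ext_val_Dia_const[of _ p w]) (rule min.cobounded2)
    then show ?thesis unfolding Four_Dia ext_val_Imp_eq_1_iff[OF assms(2)] .
  next
    case (Five_Box p)
    have "?V w (Dia (Box p)) \<le> ?V w (Box p)"
      unfolding ext_val_Dia_le_iff
      by (intro ballI, subst ext_val_Box_const[of _ p w]) (rule min.cobounded2)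
    then show ?thesis unfolding Five_Box ext_val_Imp_eq_1_iff[OF assms(2)] .
  next
    case (Five_Dia p)
    have "?V w (Dia p) \<le> ?V w (Box (Dia p))"
      unfolding le_ext_val_Box_iff[OF u]
      by (intro ballI, subst ext_val_Dia_const[of _ p w]) (rule min.cobounded1)
    then show ?thesis unfolding Five_Dia ext_val_Imp_eq_1_iff[OF assms(2)] .
  qed
next
  case D
  \<comment> \<open>\<open>Top\<close> has value 1, so \<open>Dia Top\<close> evaluates to the
    supremum of the weights; this is where normalisation enters.\<close>
  have "(\<lambda>v. min (\<pi> v) (ext_val W \<pi> e v Top)) ` W = \<pi> ` W"
    using model by (intro image_cong) (auto simp: PiG_model_def godel_imp_def)
  then show ?thesis using model D by (simp add: PiG_model_def)
qed

end

text \<open>The induction leaves \<open>w\<close> arbitrary: in the case \<open>Nec\<close> the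
  premise has no assumptions and so has value 1 at all worlds, as the box requires.\<close>

lemma KD45G_sound:
  assumes "T \<turnstile> p" "PiG_model W \<pi> e" "w \<in> W" "\<forall>q\<in>T. ext_val W \<pi> e w q = 1"
  shows "ext_val W \<pi> e w p = 1"
  using assms(1,3,4)
proof (induction arbitrary: w rule: KD45G_derives.induct)
  case (Ax p T)
  then show ?case using KD45G_axiom_sound[OF assms(2)] by blast
next
  case (MP T p q)
  then have "1 \<le> ext_val W \<pi> e w q"
    using ext_val_Imp_eq_1_iff[OF assms(2), of w p q] by simp
  then show ?case using ext_val_unit[OF assms(2) MP.prems(1), of q] by simp
next
  case (Nec p T)
  then have "\<forall>v\<in>W. ext_val W \<pi> e v p = 1" by simp
  then have "1 \<le> ext_val W \<pi> e w (Box p)"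
    by (subst le_ext_val_Box_iff[OF assms(2)]) auto
  then show ?case using ext_val_unit[OF assms(2) Nec.prems(1), of "Box p"] by simp
qed blast

section \<open>Real-valued ranks\<close>

lemma finite_sets_between:
  fixes L U :: "real set"
  assumes "finite L" "finite U" "\<And>l u. l \<in> L \<Longrightarrow> u \<in> U \<Longrightarrow> l < u"
  shows "\<exists>t. (\<forall>l\<in>L. l < t) \<and> (\<forall>u\<in>U. t < u)"
proof (cases "L = {} \<or> U = {}")
  case True
  then show ?thesis
  proof
    assume "L = {}"
    \<comment> \<open>The element 0 only ensures that the minimum is taken over a non-empty
      set.\<close>
    moreover have "Min (insert 0 U) - 1 < u" if "u \<in> U" for u
      using Min_le[OF finite.insertI[OF assms(2)], of u 0] that by (simp del: Min_insert)
    ultimately show ?thesis by blast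
  next
    assume "U = {}"
    moreover have "l < Max (insert 0 L) + 1" if "l \<in> L" for l
      using Max_ge[OF finite.insertI[OF assms(1)], of l 0] that by (simp del: Max_insert)
    ultimately show ?thesis by blast
  qed
next
  case False
  then have "Max L < Min U" using assms by simp
  then obtain t where "Max L < t" "t < Min U" using dense by blast
  then show ?thesis using False assms(1,2) by auto
qed

text \<open>Points are added one at a time. A point equivalent to an earlier one takes its value;
  any other is placed by density between the values below and above it, with \<open>c\<close> among
  the upper bounds. Values on \<open>A\<close> never change, so prescribed ones survive.\<close>

lemma extend_rank:
  fixes f :: "'a \<Rightarrow> real"
  assumes "finite B" "finite A"
    and total: "\<And>x y. P x y \<or> P y x"
    and trans: "\<And>x y z. P x y \<Longrightarrow> P y z \<Longrightarrow> P x z"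
    and A: "\<And>x y. x \<in> A \<Longrightarrow> y \<in> A \<Longrightarrow> f x \<le> f y \<longleftrightarrow> P x y" "\<And>x. x \<in> A \<Longrightarrow> f x < c"
  shows "\<exists>g. (\<forall>x\<in>A. g x = f x) \<and> (\<forall>x\<in>A \<union> B. \<forall>y\<in>A \<union> B. g x \<le> g y \<longleftrightarrow> P x y)
    \<and> (\<forall>x\<in>A \<union> B. g x < c)"
  using assms(1)
proof (induction B rule: finite_induct)
  case empty
  then show ?case using A by (intro exI[of _ f]) simp
next
  case (insert x B)
  let ?X = "A \<union> B"
  from insert.IH obtain g where gA: "\<And>y. y \<in> A \<Longrightarrow> g y = f y"
    and g: "\<And>y z. y \<in> ?X \<Longrightarrow> z \<in> ?X \<Longrightarrow> g y \<le> g z \<longleftrightarrow> P y z"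
    and gc: "\<And>y. y \<in> ?X \<Longrightarrow> g y < c" by metis
  have refl: "P y y" for y using total by blast
  show ?case
  proof (cases "x \<in> A")
    case True
    then have "A \<union> insert x B = ?X" by blast
    then show ?thesis using gA g gc by (intro exI[of _ g]) simp
  next
    case x: False
    obtain t where t: "t < c" "\<forall>y\<in>?X. (g y \<le> t \<longleftrightarrow> P y x) \<and> (t \<le> g y \<longleftrightarrow> P x y)"
    proof (cases "\<exists>y\<in>?X. P x y \<and> P y x")
      case True
      then obtain y where y: "y \<in> ?X" "P x y" "P y x" by blast
      then have "(g z \<le> g y \<longleftrightarrow> P z x) \<and> (g y \<le> g z \<longleftrightarrow> P x z)" if "z \<in> ?X" for z
        using g[OF that y(1)] g[OF y(1) that] trans[of z y x] trans[of z x y] trans[of x y z]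
          trans[of y x z] y by blast
      then show ?thesis using that gc y(1) by blast
    next
      case neq: False
      let ?L = "g ` {y \<in> ?X. P y x}" and ?U = "insert c (g ` {y \<in> ?X. P x y})"
      have "l < u" if l: "l \<in> ?L" and u: "u \<in> ?U" for l u
      proof -
        from l obtain y where y: "y \<in> ?X" "P y x" "l = g y" by blast
        show ?thesis
        proof (cases "u = c")
          case False
          then obtain z where z: "z \<in> ?X" "P x z" "u = g z" using u by blast
          then have "\<not> P z y" using trans[OF z(2), of y] y(1,2) neq by blast
          then show ?thesis using g[OF z(1) y(1)] y z by simp
        qed (use gc y in simp)
      qed
      moreover have "finite ?L" "finite ?U" using insert.hyps assms(2) by simp_all
      ultimately obtain t where t: "\<forall>l\<in>?L. l < t" "\<forall>u\<in>?U. t < u"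
        using finite_sets_between[of ?L ?U] by blast
      have "(g y \<le> t \<longleftrightarrow> P y x) \<and> (t \<le> g y \<longleftrightarrow> P x y)" if y: "y \<in> ?X" for y
      proof (cases "P y x")
        case True
        then have "g y < t" "\<not> P x y" using t(1) y neq by auto
        then show ?thesis using True by simp
      next
        case nle: False
        then have "P x y" "t < g y" using total t(2) y by auto
        then show ?thesis using nle by simp
      qed
      then show ?thesis using that t(2) by blast
    qed
    have "(g(x := t)) y \<le> (g(x := t)) z \<longleftrightarrow> P y z"
      if "y \<in> insert x ?X" "z \<in> insert x ?X" for y z
      using that t(2) g refl by (cases "y = x"; cases "z = x") auto
    then show ?thesis using gA gc t(1) x by (intro exI[of _ "g(x := t)"]) auto
  qed
qed

text \<open>Only formulas outside \<open>D\<close> are ranked, since those in \<open>D\<close> form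
  a single top class. \<open>Bot\<close> with value 0 in \<open>A\<close> makes all ranks
  non-negative.\<close>

lemma linear_theory_rank:
  assumes D: "linear_theory D" and "finite F" and A: "A \<subseteq> F - D" "Bot \<in> A" "f Bot = 0"
    and f: "\<And>x y. x \<in> A \<Longrightarrow> y \<in> A \<Longrightarrow> f x \<le> f y \<longleftrightarrow> x \<rightarrow> y \<in> D" "\<And>x. x \<in> A \<Longrightarrow> f x < c"
  obtains g :: "'v fm \<Rightarrow> real" where "\<And>x. x \<in> A \<Longrightarrow> g x = f x"
    "\<And>x y. x \<in> F - D \<Longrightarrow> y \<in> F - D \<Longrightarrow> g x \<le> g y \<longleftrightarrow> x \<rightarrow> y \<in> D"
    "\<And>x. x \<in> F - D \<Longrightarrow> 0 \<le> g x \<and> g x < c"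
proof -
  have "finite (F - D)" "finite A" using assms(2) A(1) by (auto intro: finite_subset)
  from extend_rank[OF this, of "\<lambda>x y. x \<rightarrow> y \<in> D" f c]
  obtain g where g: "\<forall>x\<in>A. g x = f x"
    "\<forall>x\<in>A \<union> (F - D). \<forall>y\<in>A \<union> (F - D). g x \<le> g y \<longleftrightarrow> x \<rightarrow> y \<in> D"
    "\<forall>x\<in>A \<union> (F - D). g x < c"
    using linear_theory_total[OF D] linear_theory_trans[OF D] f by blast
  have "Bot \<rightarrow> x \<in> D" for x
    using linear_theory_thm[OF D ax_G[OF G_axiom.G8]] .
  then have "0 \<le> g x" if "x \<in> F - D" for x using g(1,2) A that by (metis UnCI)
  then show thesis using g that by blast
qed

section \<open>Canonical worlds\<close>

text \<open>In a canonical model the modal formulas take the same value \<open>k\<close> at all worlds,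
  so a world is just a propositional valuation.\<close>

primrec pval :: "('v fm \<Rightarrow> real) \<Rightarrow> ('v \<Rightarrow> real) \<Rightarrow> 'v fm \<Rightarrow> real" where
  "pval k e (Var x) = e x"
| "pval k e Bot = 0"
| "pval k e (And p q) = min (pval k e p) (pval k e q)"
| "pval k e (p \<rightarrow> q) = godel_imp (pval k e p) (pval k e q)"
| "pval k e (Box p) = k (Box p)"
| "pval k e (Dia p) = k (Dia p)"

lemma pval_unit:
  assumes "\<And>p. k p \<in> {0..1}" "\<And>x. e x \<in> {0..1}"
  shows "pval k e p \<in> {0..1}"
  by (induction p) (use assms godel_imp_unit in \<open>auto simp: min_le_iff_disj\<close>)

section \<open>Subformulas and sets closed under them\<close>

primrec subfm :: "'v fm \<Rightarrow> 'v fm set" where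
  "subfm (Var x) = {Var x}"
| "subfm Bot = {Bot}"
| "subfm (And p q) = insert (And p q) (subfm p \<union> subfm q)"
| "subfm (p \<rightarrow> q) = insert (p \<rightarrow> q) (subfm p \<union> subfm q)"
| "subfm (Box p) = insert (Box p) (subfm p)"
| "subfm (Dia p) = insert (Dia p) (subfm p)"

lemma finite_subfm: "finite (subfm p)"
  by (induction p) auto

lemma subfm_refl: "p \<in> subfm p"
  by (cases p) auto

lemma subfm_trans: "q \<in> subfm p \<Longrightarrow> subfm q \<subseteq> subfm p"
  by (induction p) auto

definition subfm_closed :: "'v fm set \<Rightarrow> bool" where
  "subfm_closed F \<longleftrightarrow> (\<forall>p\<in>F. subfm p \<subseteq> F)"

lemma subfm_closedD:
  assumes "subfm_closed F"
  shows "And p q \<in> F \<Longrightarrow> p \<in> F \<and> q \<in> F" "p \<rightarrow> q \<in> F \<Longrightarrow> p \<in> F \<and> q \<in> F"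
    "Box p \<in> F \<Longrightarrow> p \<in> F" "Dia p \<in> F \<Longrightarrow> p \<in> F"
  using assms subfm_refl unfolding subfm_closed_def by fastforce+

text \<open>Truth lemma with a threshold: members of \<open>D\<close> only get a lower bound,
  because modal formulas among them may have prescribed values below 1. Outside \<open>D\<close>, a
  conjunction is equivalent to its smaller conjunct and an implication to its conclusion, so the
  exact ranks agree.\<close>

lemma pval_rank:
  assumes D: "linear_theory D" and F: "subfm_closed F" and c: "0 < c" "c \<le> 1"
    and Bot: "Bot \<notin> D" "g Bot = 0"
    and g: "\<And>x y. x \<in> F - D \<Longrightarrow> y \<in> F - D \<Longrightarrow> g x \<le> g y \<longleftrightarrow> x \<rightarrow> y \<in> D"
      "\<And>x. x \<in> F - D \<Longrightarrow> g x < c"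
    and Var: "\<And>x. Var x \<in> F \<Longrightarrow> if Var x \<in> D then c \<le> e x else e x = g (Var x)"
    and Box: "\<And>p. Box p \<in> F \<Longrightarrow> if Box p \<in> D then c \<le> k (Box p) else k (Box p) = g (Box p)"
    and Dia: "\<And>p. Dia p \<in> F \<Longrightarrow> if Dia p \<in> D then c \<le> k (Dia p) else k (Dia p) = g (Dia p)"
  shows "p \<in> F \<Longrightarrow> if p \<in> D then c \<le> pval k e p else pval k e p = g p"
proof (induction p)
  case (And p q)
  have eq: "g x = g y" if "x \<in> F - D" "y \<in> F - D" "x \<rightarrow> y \<in> D" "y \<rightarrow> x \<in> D" for x y
    using g(1) that by (meson antisym)
  have pq: "p \<in> F" "q \<in> F" using subfm_closedD(1)[OF F And.prems] by auto
  note And1 = linear_theory_And1[OF D, of p q] and And2 = linear_theory_And2[OF D, of p q]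
  have p: "if p \<in> D then c \<le> pval k e p else pval k e p = g p"
    and q: "if q \<in> D then c \<le> pval k e q else pval k e q = g q" using And pq by auto
  show ?case
  proof (cases "And p q \<in> D")
    case True
    then show ?thesis using p q linear_theory_And_iff[OF D, of p q] by simp
  next
    case nD: False
    have "min (pval k e p) (pval k e q) = g (And p q)"
    proof (cases "p \<rightarrow> q \<in> D")
      case True
      then have "p \<notin> D" using nD linear_theory_And_iff[OF D] linear_theory_MP[OF D] by blast
      moreover from this have "g (And p q) = g p"
        using eq And.prems pq nD And1 linear_theory_And3[OF D True] by blast
      moreover have "g p \<le> pval k e q"
        using q g pq True \<open>p \<notin> D\<close> by (cases "q \<in> D") force+
      ultimately show ?thesis using p by simp
    next
      case False
      then have "q \<rightarrow> p \<in> D" "q \<notin> D"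
        using linear_theory_total[OF D] linear_theory_weaken[OF D] by blast+
      moreover from this have "g (And p q) = g q"
        using eq And.prems pq nD And2 linear_theory_And4[OF D] by blast
      moreover have "g q \<le> pval k e p"
        using p g pq calculation(1,2) by (cases "p \<in> D") force+
      ultimately show ?thesis using q by simp
    qed
    then show ?thesis using nD by simp
  qed
next
  case (Imp p q)
  have pq: "p \<in> F" "q \<in> F" using subfm_closedD(2)[OF F Imp.prems] by auto
  have p: "if p \<in> D then c \<le> pval k e p else pval k e p = g p"
    and q: "if q \<in> D then c \<le> pval k e q else pval k e q = g q" using Imp pq by auto
  show ?case
  proof (cases "p \<rightarrow> q \<in> D")
    case True
    have "c \<le> pval k e q \<or> pval k e p \<le> pval k e q"
    proof (cases "q \<in> D")
      case False
      then have "p \<notin> D" using True linear_theory_MP[OF D] by blast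
      then show ?thesis using p q False True g(1) pq by auto
    qed (use q in simp)
    then show ?thesis using True c by (auto simp: godel_imp_def)
  next
    case nD: False
    then have nq: "q \<notin> D" using linear_theory_weaken[OF D] by blast
    then have "g (p \<rightarrow> q) = g q"
      using g(1) Imp.prems pq nD linear_theory_Imp1[OF D] linear_theory_Imp2[OF D nD]
      by (meson DiffI antisym)
    moreover have "g q < pval k e p"
      using p nq nD g pq by (cases "p \<in> D") force+
    ultimately show ?thesis using nD nq q by (simp add: godel_imp_def)
  qed
qed (use assms in auto)

text \<open>A world of weight \<open>c\<close> satisfying these conditions neither pulls the infimum
  for \<open>Box p\<close> below \<open>k (Box p)\<close> nor pushes the supremum for
  \<open>Dia p\<close> above \<open>k (Dia p)\<close>.\<close>

definition world :: "'v fm set \<Rightarrow> ('v fm \<Rightarrow> real) \<Rightarrow> real \<Rightarrow> ('v \<Rightarrow> real) \<Rightarrow> bool" where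
  "world F k c e \<longleftrightarrow> c \<in> {0..1} \<and> (\<forall>x. e x \<in> {0..1}) \<and>
     (\<forall>p. Box p \<in> F \<longrightarrow> min (k (Box p)) c \<le> pval k e p) \<and>
     (\<forall>p. Dia p \<in> F \<longrightarrow> min c (pval k e p) \<le> k (Dia p))"

lemma linear_theory_valuation:
  assumes D: "linear_theory D" "Bot \<notin> D" and F: "finite F" "subfm_closed F" "Bot \<in> F"
  obtains k :: "'v fm \<Rightarrow> real" where "\<And>p. k p \<in> {0..1}" "k Bot = 0"
    "\<And>p q. p \<in> F \<Longrightarrow> q \<in> F \<Longrightarrow> k p \<le> k q \<longleftrightarrow> p \<rightarrow> q \<in> D"
    "\<And>p. p \<in> F \<Longrightarrow> k p = 1 \<longleftrightarrow> p \<in> D"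
    "\<And>p. p \<in> F \<Longrightarrow> pval k (\<lambda>x. k (Var x)) p = k p"
proof -
  have "Bot \<rightarrow> Bot \<in> D" by (rule linear_theory_thm[OF D(1) derives_refl])
  then obtain g :: "'v fm \<Rightarrow> real" where g: "\<And>x. x \<in> {Bot} \<Longrightarrow> g x = 0"
    "\<And>x y. x \<in> F - D \<Longrightarrow> y \<in> F - D \<Longrightarrow> g x \<le> g y \<longleftrightarrow> x \<rightarrow> y \<in> D"
    "\<And>x. x \<in> F - D \<Longrightarrow> 0 \<le> g x \<and> g x < 1"
    using D F by (elim linear_theory_rank[of D F "{Bot}" "\<lambda>_. 0" 1, rotated -1]) auto
  \<comment> \<open>Members of \<open>D\<close> get the top value, so that \<open>pval_rank\<close>
    applies with threshold 1. The value 0 for formulas outside both sets is a default that keeps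
    \<open>k\<close> within the unit interval.\<close>
  define k where "k = (\<lambda>p. if p \<in> D then 1 else if p \<in> F then g p else 0)"
  have unit: "k p \<in> {0..1}" for p using g(3)[of p] by (auto simp: k_def)
  have "if p \<in> D then 1 \<le> pval k (\<lambda>x. k (Var x)) p else pval k (\<lambda>x. k (Var x)) p = g p"
    if "p \<in> F" for p
    by (rule pval_rank[where D = D and F = F]) (use D F that g in \<open>simp_all add: k_def\<close>)
  moreover have "pval k (\<lambda>x. k (Var x)) p \<le> 1" for p
    using pval_unit[of k "\<lambda>x. k (Var x)" p] unit by simp
  moreover have "k p = (if p \<in> D then 1 else g p)" if "p \<in> F" for p
    using that by (simp add: k_def)
  ultimately have pval: "pval k (\<lambda>x. k (Var x)) p = k p" if "p \<in> F" for p
    using that by (metis antisym)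
  have "k p \<le> k q \<longleftrightarrow> p \<rightarrow> q \<in> D" if pq: "p \<in> F" "q \<in> F" for p q
  proof (cases "q \<in> D")
    case True
    then show ?thesis using unit[of p] linear_theory_weaken[OF D(1)] by (simp add: k_def)
  next
    case q: False
    show ?thesis
    proof (cases "p \<in> D")
      case True
      then have "p \<rightarrow> q \<notin> D" using q linear_theory_MP[OF D(1)] by blast
      then show ?thesis using True q pq g(3)[of q] by (simp add: k_def)
    next
      case False
      then show ?thesis using q pq g(2) by (simp add: k_def)
    qed
  qed
  moreover have "k p = 1 \<longleftrightarrow> p \<in> D" if "p \<in> F" for p using g(3)[of p] that by (auto simp: k_def)
  moreover have "k Bot = 0" using g(1) D(2) F(3) by (simp add: k_def)
  ultimately show thesis using that unit pval by blast
qed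

text \<open>Rigid formulas of \<open>F\<close> outside \<open>E\<close> have \<open>k\<close>-values
  below \<open>k m\<close>, hence below \<open>c\<close>, and are ordered by \<open>E\<close> as by
  \<open>k\<close>; so ranks for \<open>E\<close> can extend \<open>k\<close> on them. Those in
  \<open>E\<close> have values at least \<open>k m\<close>, hence at least \<open>c\<close>. The
  implications from \<open>Box p\<close> to \<open>p\<close> and from \<open>p\<close> to
  \<open>Dia p\<close> in \<open>E\<close> give the conditions of \<open>world\<close>.\<close>

lemma cut_theory_world:
  fixes F :: "'v fm set"
  assumes D: "linear_theory D" and F: "finite F" "subfm_closed F" "Bot \<in> F"
    and k: "\<And>p. k p \<in> {0..1}" "k Bot = 0"
      "\<And>p q. p \<in> F \<Longrightarrow> q \<in> F \<Longrightarrow> k p \<le> k q \<longleftrightarrow> p \<rightarrow> q \<in> D"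
    and E: "cut_theory F D m E" and m: "m \<in> F"
    and c: "0 < c" "c \<le> k m" "\<And>a. a \<in> F \<Longrightarrow> rigid a \<Longrightarrow> k a < k m \<Longrightarrow> k a < c"
  obtains e where "world F k c e" "\<And>p. p \<in> F \<Longrightarrow> p \<in> E \<Longrightarrow> c \<le> pval k e p"
    "\<And>p. p \<in> F \<Longrightarrow> p \<notin> E \<Longrightarrow> pval k e p < c"
proof -
  have E': "linear_theory E" using E unfolding cut_theory_def by blast
  have rigid: "a \<in> E \<longleftrightarrow> k m \<le> k a" if "a \<in> F" "rigid a" for a
    using cut_theory_rigid_iff[OF D E that] k(3)[OF m that(1)] by simp
  have c1: "c \<le> 1" using c(2) k(1)[of m] by simp
  have Bot: "Bot \<notin> E" using rigid[OF F(3) rigid_Bot] c k(2) by simp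
  let ?A = "{a \<in> F. rigid a \<and> a \<notin> E}"
  obtain g :: "'v fm \<Rightarrow> real" where gA: "\<And>x. x \<in> ?A \<Longrightarrow> g x = k x"
    and g: "\<And>x y. x \<in> F - E \<Longrightarrow> y \<in> F - E \<Longrightarrow> g x \<le> g y \<longleftrightarrow> x \<rightarrow> y \<in> E"
      "\<And>x. x \<in> F - E \<Longrightarrow> 0 \<le> g x \<and> g x < c"
  proof (rule linear_theory_rank[of E F ?A k c])
    show "k x \<le> k y \<longleftrightarrow> x \<rightarrow> y \<in> E" if "x \<in> ?A" "y \<in> ?A" for x y
      using that cut_theory_order[OF D E] k(3) by simp
    show "k x < c" if "x \<in> ?A" for x
      using that rigid[of x] c(3)[of x] by simp
  qed (use E' F Bot rigid_Bot k(2) in auto)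
  have modal: "if a \<in> E then c \<le> k a else k a = g a" if "a \<in> F" "rigid a" for a
    using that rigid[OF that] gA[of a] c(2) by auto
  \<comment> \<open>A variable in \<open>E\<close> needs a value of at least \<open>c\<close>, and 1
    serves; the value 0 for variables outside \<open>F\<close> is a default.\<close>
  define e where "e = (\<lambda>x. if Var x \<in> E then 1 else if Var x \<in> F then g (Var x) else 0)"
  have pval: "if p \<in> E then c \<le> pval k e p else pval k e p = g p" if "p \<in> F" for p
  proof (rule pval_rank[where F = F])
    show "g Bot = 0" using gA[of Bot] F(3) rigid_Bot Bot k(2) by simp
    show "if Box q \<in> E then c \<le> k (Box q) else k (Box q) = g (Box q)" if "Box q \<in> F" for q
      using modal[OF that rigid_Box] .
    show "if Dia q \<in> E then c \<le> k (Dia q) else k (Dia q) = g (Dia q)" if "Dia q \<in> F" for q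
      using modal[OF that rigid_Dia] .
  qed (use E' F c(1) c1 Bot g that in \<open>auto simp: e_def\<close>)
  have "world F k c e"
    unfolding world_def
  proof (intro conjI allI impI)
    show "e x \<in> {0..1}" for x using g(2)[of "Var x"] c1 by (auto simp: e_def)
  next
    fix p assume B: "Box p \<in> F"
    then have p: "p \<in> F" using subfm_closedD[OF F(2)] by blast
    show "min (k (Box p)) c \<le> pval k e p"
    proof (cases "p \<in> E")
      case False
      then have "Box p \<notin> E" using cut_theory_Box[OF D E] linear_theory_MP[OF E'] by blast
      then have "k (Box p) \<le> pval k e p"
        using g(1)[of "Box p" p] modal[OF B rigid_Box] pval[OF p] B p False cut_theory_Box[OF D E]
        by simp
      then show ?thesis by simp
    qed (use pval[OF p] in simp)
  next
    fix p assume B: "Dia p \<in> F"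
    then have p: "p \<in> F" using subfm_closedD[OF F(2)] by blast
    show "min c (pval k e p) \<le> k (Dia p)"
    proof (cases "Dia p \<in> E")
      case False
      then have "p \<notin> E" using cut_theory_Dia[OF D E] linear_theory_MP[OF E'] by blast
      then have "pval k e p \<le> k (Dia p)"
        using g(1)[of p "Dia p"] modal[OF B rigid_Dia] pval[OF p] B p False cut_theory_Dia[OF D E]
        by simp
      then show ?thesis by simp
    qed (use modal[OF B rigid_Dia] in simp)
  qed (use c(1) c1 in simp)
  moreover have "pval k e p < c" if "p \<in> F" "p \<notin> E" for p
    using pval[OF that(1)] that g(2)[of p] by simp
  ultimately show thesis using that pval by simp
qed

text \<open>\<open>m\<close> has the least value above \<open>k (Box p)\<close> among rigid formulas
  of \<open>F\<close>; \<open>Dia Top\<close> guarantees that one exists. The weight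
  \<open>c\<close> lies strictly between \<open>k (Box p)\<close> and both \<open>b\<close> and
  \<open>k m\<close>. As \<open>p\<close> has value below \<open>c\<close>, this world brings the
  infimum for \<open>Box p\<close> below \<open>b\<close>; letting \<open>b\<close> decrease, the
  infimum is approached.\<close>

lemma Box_world:
  assumes D: "linear_theory D" and F: "finite F" "subfm_closed F" "Bot \<in> F"
    and k: "\<And>p. k p \<in> {0..1}" "k Bot = 0"
      "\<And>p q. p \<in> F \<Longrightarrow> q \<in> F \<Longrightarrow> k p \<le> k q \<longleftrightarrow> p \<rightarrow> q \<in> D"
    and Top: "Dia Top \<in> F" "k (Dia Top) = 1"
    and p: "Box p \<in> F" "k (Box p) < b"
    and lt: "k (Box p) < 1"
  obtains c e where "world F k c e" "pval k e p < c" "c < b"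
proof -
  let ?M = "{a \<in> F. rigid a \<and> k (Box p) < k a}"
  have "Dia Top \<in> ?M" using Top lt rigid_Dia by simp
  then have M: "finite ?M" "?M \<noteq> {}" using F(1) by auto
  obtain m where m: "m \<in> ?M" "\<And>a. a \<in> ?M \<Longrightarrow> k m \<le> k a"
    using that[of "arg_min_on k ?M"] arg_min_if_finite(1)[OF M] arg_min_least[OF M] by blast
  have "k (Box p) < min b (k m)" using p(2) m(1) by simp
  then obtain c where c: "k (Box p) < c" "c < min b (k m)" using dense by blast
  obtain E where E: "cut_theory F D m E" "p \<notin> E"
  proof (rule exists_cut_theory_Box[OF D, of m p F])
    show "m \<rightarrow> Box p \<notin> D" using m(1) k(3)[of m "Box p"] p(1) by simp
    show "m \<rightarrow> a \<in> D \<or> a \<rightarrow> Box p \<in> D" if "a \<in> F" "rigid a" for a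
      using that m k(3)[of m a] k(3)[of a "Box p"] p(1) by force
  qed
  obtain e where "world F k c e" "\<And>p. p \<in> F \<Longrightarrow> p \<notin> E \<Longrightarrow> pval k e p < c"
  proof (rule cut_theory_world[OF D F k E(1), of c])
    show "k a < c" if "a \<in> F" "rigid a" "k a < k m" for a
      using m(2)[of a] that c(1) by force
    show "0 < c" using c(1) k(1)[of "Box p"] by simp
  qed (use c m(1) in auto)
  then show thesis using that c(2) E(2) subfm_closedD(3)[OF F(2) p(1)] by simp
qed

text \<open>Here \<open>m\<close> is \<open>Dia p\<close> itself and the weight is exactly its
  value, so the supremum is attained. The formula \<open>b\<close> to be avoided has the greatest
  value below it among rigid formulas of \<open>F\<close>; \<open>Bot\<close> guarantees
  existence.\<close>

lemma Dia_world:
  assumes D: "linear_theory D" and F: "finite F" "subfm_closed F" "Bot \<in> F"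
    and k: "\<And>p. k p \<in> {0..1}" "k Bot = 0"
      "\<And>p q. p \<in> F \<Longrightarrow> q \<in> F \<Longrightarrow> k p \<le> k q \<longleftrightarrow> p \<rightarrow> q \<in> D"
    and p: "Dia p \<in> F" "0 < k (Dia p)"
  obtains e where "world F k (k (Dia p)) e" "k (Dia p) \<le> pval k e p"
proof -
  let ?M = "{a \<in> F. rigid a \<and> k a < k (Dia p)}"
  have "Bot \<in> ?M" using F(3) p(2) k(2) rigid_Bot by simp
  then have M: "finite ?M" "?M \<noteq> {}" using F(1) by auto
  have "k a \<le> k (arg_min_on (\<lambda>a. - k a) ?M)" if "a \<in> ?M" for a
    using arg_min_least[OF M that, of "\<lambda>a. - k a"] by simp
  then obtain b where b: "b \<in> ?M" "\<And>a. a \<in> ?M \<Longrightarrow> k a \<le> k b"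
    using arg_min_if_finite(1)[OF M] by blast
  obtain E where E: "cut_theory F D (Dia p) E" "p \<in> E"
  proof (rule exists_cut_theory_Dia[OF D, of b p F])
    show "Dia p \<rightarrow> b \<notin> D" using b(1) k(3)[of "Dia p" b] p(1) by simp
    show "Dia p \<rightarrow> a \<in> D \<or> a \<rightarrow> b \<in> D" if "a \<in> F" "rigid a" for a
      using that b k(3)[of a b] k(3)[of "Dia p" a] p(1) by force
  qed (use b(1) in simp)
  show thesis
    by (rule cut_theory_world[OF D F k E(1), of "k (Dia p)"])
      (use p that E(2) subfm_closedD(4)[OF F(2) p(1)] in auto)
qed

section \<open>Completeness\<close>

text \<open>For each modal operator one inequality comes from \<open>world\<close> and the other
  from the witnesses: approximate for \<open>Box\<close>, exact for \<open>Dia\<close>. A box of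
  value 1 is bounded by 1 anyway.\<close>

lemma ext_val_canonical:
  fixes e :: "'w \<Rightarrow> 'v \<Rightarrow> real"
  assumes F: "subfm_closed F" and k: "\<And>p. k p \<in> {0..1}"
    and w: "\<And>w. world F k (\<pi> w) (e w)"
    and Box: "\<And>p \<epsilon>. Box p \<in> F \<Longrightarrow> k (Box p) < 1 \<Longrightarrow> 0 < \<epsilon> \<Longrightarrow>
      \<exists>w. pval k (e w) p < \<pi> w \<and> \<pi> w < k (Box p) + \<epsilon>"
    and Dia: "\<And>p. Dia p \<in> F \<Longrightarrow> \<exists>w. k (Dia p) \<le> pval k (e w) p \<and> \<pi> w = k (Dia p)"
    and model: "PiG_model UNIV \<pi> e"
  shows "p \<in> F \<Longrightarrow> ext_val UNIV \<pi> e w p = pval k (e w) p"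
proof (induction p arbitrary: w)
  case (Box p)
  have V: "ext_val UNIV \<pi> e v p = pval k (e v) p" for v
    using Box.IH subfm_closedD(3)[OF F Box.prems] by blast
  have unit: "k (Box p) \<le> 1" using k[of "Box p"] by simp
  have "k (Box p) \<le> ext_val UNIV \<pi> e w (Box p)"
    unfolding le_ext_val_Box_iff[OF model unit] V
    using w Box.prems unfolding world_def by blast
  moreover have "ext_val UNIV \<pi> e w (Box p) \<le> k (Box p)"
  proof (cases "k (Box p) = 1")
    case True
    then show ?thesis using ext_val_le_1[OF model UNIV_I] by (simp del: ext_val.simps)
  next
    case False
    then have "k (Box p) < 1" using unit by linarith
    show ?thesis
    proof (rule field_le_epsilon)
      fix \<epsilon> :: real assume "0 < \<epsilon>"
      then obtain v where v: "pval k (e v) p < \<pi> v" "\<pi> v < k (Box p) + \<epsilon>"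
        using assms(4)[OF Box.prems \<open>k (Box p) < 1\<close>] by blast
      have "min (ext_val UNIV \<pi> e w (Box p)) (\<pi> v) \<le> pval k (e v) p"
        using ext_val_BoxD[OF model UNIV_I, of v p] V ext_val_Box_const[OF model, of w p v]
        by (simp del: ext_val.simps)
      then show "ext_val UNIV \<pi> e w (Box p) \<le> k (Box p) + \<epsilon>" using v by linarith
    qed
  qed
  ultimately show ?case by (simp del: ext_val.simps)
next
  case (Dia p)
  have V: "ext_val UNIV \<pi> e v p = pval k (e v) p" for v
    using Dia.IH subfm_closedD(4)[OF F Dia.prems] by blast
  have "ext_val UNIV \<pi> e w (Dia p) \<le> k (Dia p)"
    unfolding ext_val_Dia_le_iff[OF model] V
    using w Dia.prems unfolding world_def by blast
  moreover obtain v where "k (Dia p) \<le> pval k (e v) p" "\<pi> v = k (Dia p)"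
    using assms(5)[OF Dia.prems] by blast
  then have "k (Dia p) \<le> ext_val UNIV \<pi> e w (Dia p)"
    using ext_val_DiaD[OF model UNIV_I, of v p] V ext_val_Dia_const[OF model, of w p v]
    by (simp del: ext_val.simps)
  ultimately show ?case by (simp del: ext_val.simps)
next
  case (And p q)
  then show ?case using subfm_closedD(1)[OF F And.prems] by simp
next
  case (Imp p q)
  then show ?case using subfm_closedD(2)[OF F Imp.prems] by simp
qed simp_all

lemma KD45G_countermodel:
  fixes T :: "'v fm set"
  assumes "finite T" "\<not> T \<turnstile> \<phi>"
  shows "\<not> PiG_entails TYPE('v fm \<times> nat) T \<phi>"
proof -
  from assms(2) obtain D where D: "T \<subseteq> D" "linear_theory D" "\<phi> \<notin> D" by (rule lindenbaum)
  have BotD: "Bot \<notin> D"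
    using D(3) linear_theory_MP[OF D(2)] linear_theory_thm[OF D(2) ax_G[OF G_axiom.G8]] by blast
  \<comment> \<open>\<open>Dia Top\<close> is included for two reasons: it is a rigid formula above
    every box of value less than 1, and its witness will have weight 1.\<close>
  define F where "F = (\<Union>p\<in>insert \<phi> (insert (Dia Top) T). subfm p)"
  have F: "finite F" "subfm_closed F" "Bot \<in> F"
    unfolding F_def subfm_closed_def using assms(1) finite_subfm subfm_trans by (blast, blast, simp)
  have inF: "\<phi> \<in> F" "Dia Top \<in> F" "T \<subseteq> F" unfolding F_def using subfm_refl by blast+
  obtain k :: "'v fm \<Rightarrow> real" where k: "\<And>p. k p \<in> {0..1}" "k Bot = 0"
    "\<And>p q. p \<in> F \<Longrightarrow> q \<in> F \<Longrightarrow> k p \<le> k q \<longleftrightarrow> p \<rightarrow> q \<in> D"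
    and k1: "\<And>p. p \<in> F \<Longrightarrow> k p = 1 \<longleftrightarrow> p \<in> D"
    and pval: "\<And>p. p \<in> F \<Longrightarrow> pval k (\<lambda>x. k (Var x)) p = k p"
  proof (rule linear_theory_valuation[OF D(2) BotD F], goal_cases)
    case (1 k)
    from 1(2-) show ?case by (rule 1(1))
  qed
  have Top: "k (Dia Top) = 1"
    using k1[OF inF(2)] linear_theory_thm[OF D(2) KD45G_derives.Ax[OF KD45G_axiom.D]] by simp
  \<comment> \<open>Weight 0 makes both modal conditions trivial, so the valuation read off
    \<open>D\<close> is admissible.\<close>
  have root: "world F k 0 (\<lambda>x. k (Var x))"
    using k(1) pval_unit[of k "\<lambda>x. k (Var x)"] unfolding world_def
    by (auto simp: min_le_iff_disj)
  \<comment> \<open>Worlds are indexed by requests: \<open>(Box p, n)\<close> asks for a witness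
    with precision \<open>1 / Suc n\<close>, \<open>(Dia p, n)\<close> for an exact one, and
    \<open>(Bot, n)\<close> for the valuation of \<open>D\<close>, at which \<open>T\<close> holds
    and \<open>\<phi>\<close> fails.\<close>
  define Q where "Q = (\<lambda>(q, n :: nat) (c, e). world F k c e \<and>
    (q = Bot \<longrightarrow> e = (\<lambda>x. k (Var x))) \<and>
    (\<forall>p. q = Box p \<longrightarrow> q \<in> F \<longrightarrow> k q < 1 \<longrightarrow> pval k e p < c \<and> c < k q + 1 / Suc n) \<and>
    (\<forall>p. q = Dia p \<longrightarrow> q \<in> F \<longrightarrow> k q \<le> pval k e p \<and> c = k q))"
  have "\<exists>ce. Q (q, n) ce" for q n
  proof -
    consider p where "q = Box p" "q \<in> F" "k q < 1" | p where "q = Dia p" "q \<in> F" "0 < k q"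
      | "\<nexists>p. q = Box p \<and> q \<in> F \<and> k q < 1" "\<nexists>p. q = Dia p \<and> q \<in> F \<and> 0 < k q" by blast
    then show ?thesis
    proof cases
      case (1 p)
      then obtain c e where "world F k c e" "pval k e p < c" "c < k q + 1 / Suc n"
        using Box_world[OF D(2) F k inF(2) Top, of p "k q + 1 / Suc n"] by auto
      then show ?thesis using 1 by (intro exI[of _ "(c, e)"]) (simp add: Q_def)
    next
      case (2 p)
      then obtain e where "world F k (k q) e" "k q \<le> pval k e p"
        using Dia_world[OF D(2) F k, of p] by auto
      then show ?thesis using 2 by (intro exI[of _ "(k q, e)"]) (simp add: Q_def)
    next
      case 3
      \<comment> \<open>A diamond request of value 0 is met by the valuation of \<open>D\<close>
        with weight 0.\<close>
      have "k q = 0" "0 \<le> pval k (\<lambda>x. k (Var x)) p" if "q = Dia p" "q \<in> F" for p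
        using 3(2) that k(1)[of q] pval_unit[of k "\<lambda>x. k (Var x)" p] k(1) by force+
      then show ?thesis using 3(1) root
        by (intro exI[of _ "(0, \<lambda>x. k (Var x))"]) (auto simp: Q_def)
    qed
  qed
  then have "\<forall>w. \<exists>ce. Q w ce" by simp
  then obtain h where h: "Q w (h w)" for w by metis
  define \<pi> where "\<pi> = fst \<circ> h"
  define e where "e = snd \<circ> h"
  have Q: "Q w (\<pi> w, e w)" for w using h[of w] by (simp add: \<pi>_def e_def)
  have world: "world F k (\<pi> w) (e w)" for w using Q[of w] by (cases w) (simp add: Q_def)
  have Dia: "\<exists>w. k (Dia p) \<le> pval k (e w) p \<and> \<pi> w = k (Dia p)" if "Dia p \<in> F" for p
    using Q[of "(Dia p, 0)"] that by (intro exI[of _ "(Dia p, 0)"]) (simp add: Q_def)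
  have Box: "\<exists>w. pval k (e w) p < \<pi> w \<and> \<pi> w < k (Box p) + \<epsilon>"
    if p: "Box p \<in> F" "k (Box p) < 1" "0 < \<epsilon>" for p \<epsilon>
  proof -
    obtain n where "1 / Suc n < \<epsilon>" using p(3) nat_approx_posE by blast
    then show ?thesis
      using Q[of "(Box p, n)"] p by (intro exI[of _ "(Box p, n)"]) (simp add: Q_def)
  qed
  \<comment> \<open>The witness of \<open>Dia Top\<close>, whose value is 1 by axiom
    \<open>D\<close>, normalises the model.\<close>
  obtain w where "\<pi> w = 1" using Dia[OF inF(2)] Top by auto
  then have "(SUP w. \<pi> w) = 1"
    using world by (intro cSup_eq_maximum) (auto simp: world_def intro: rev_image_eqI)
  then have model: "PiG_model UNIV \<pi> e" using world unfolding PiG_model_def world_def by auto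
  have "ext_val UNIV \<pi> e (Bot, 0) p = k p" if "p \<in> F" for p
  proof -
    have "ext_val UNIV \<pi> e (Bot, 0) p = pval k (e (Bot, 0)) p"
      by (rule ext_val_canonical[OF F(2) k(1) world Box Dia model that])
    then show ?thesis using Q[of "(Bot, 0)"] pval[OF that] by (simp add: Q_def)
  qed
  then have "\<forall>q\<in>T. ext_val UNIV \<pi> e (Bot, 0) q = 1" "ext_val UNIV \<pi> e (Bot, 0) \<phi> \<noteq> 1"
    using inF k1 D(1,3) by (simp_all add: subset_iff)
  then show ?thesis
    using model unfolding PiG_entails_def by blast
qed

theorem corollary4p1:
  fixes T :: "'v::countable fm set" and \<phi> :: "'v fm"
  assumes "infinite (UNIV :: 'w set)"
    and "finite T"
  shows "PiG_entails TYPE('w) T \<phi> \<longleftrightarrow> KD45G_derives T \<phi>"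
proof
  assume ent: "PiG_entails TYPE('w) T \<phi>"
  obtain f :: "nat \<Rightarrow> 'w" where "inj f" using infinite_countable_subset[OF assms(1)] by blast
  \<comment> \<open>The index type of the countermodel is countable, so it embeds into any infinite
    type of worlds.\<close>
  then have "inj (f \<circ> (to_nat :: 'v fm \<times> nat \<Rightarrow> nat))" by (simp add: inj_compose)
  then have "PiG_entails TYPE('v fm \<times> nat) T \<phi>" using ent by (rule PiG_entails_inj)
  then show "T \<turnstile> \<phi>" using KD45G_countermodel[OF assms(2)] by blast
next
  assume "T \<turnstile> \<phi>"
  then show "PiG_entails TYPE('w) T \<phi>"
    unfolding PiG_entails_def
    by (intro allI impI ballI) (rule KD45G_sound[where T = T])
qed

end
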